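(* For any $k\ge1$ there exists an integer $n(k)$ such that for every $n\ge n(k)$ and every $\varphi\in S_n$, the graph $G_\varphi(n)$ has no balanced $U$-cut with at most $k$ crossing edges; that is, there is no $U\subseteq[n]$ with $\frac n3\le|U|\le\frac{2n}{3}$ such that at most $k$ edges of $G_\varphi(n)$ have one endpoint in $U$ and the other in $[n]\setminus U$.
   Context: A $b$-ary tree is a rooted tree in which every vertex has at most $b$ children; the level of a vertex is its distance to the root, and level $\ell$ is filled if it contains $b^\ell$ vertices; $n_x$ is the number of vertices in the subtree rooted at $x$. A $b$-ary tree is balanced if every non-empty level except possibly the last non-empty one is filled, and $|n_x-n_y|\le1$ for any two vertices $x,y$ on the same level. For $b\in\{2,3\}$, $T_b(n)$ denotes a fixed balanced $b$-ary tree with vertex set $[n]=\{1,\dots,n\}$. For $\varphi\in S_n$, $G_\varphi(n)$ is the graph on $[n]$ with edge set $\{\{\varphi(i),\varphi(j)\}:\{i,j\}\in E(T_2(n))\}\cup E(T_3(n))$. *)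

theory Defs
  imports Complex_Main "HOL-Combinatorics.Permutations"
begin

text \<open>Undirected graphs are given by a vertex set and a set of two-element vertex sets.\<close>

definition simple_graph :: "'a set \<Rightarrow> 'a set set \<Rightarrow> bool" where
  "simple_graph V E \<longleftrightarrow> finite V \<and> E \<subseteq> {e. e \<subseteq> V \<and> card e = 2}"

definition graph_walk :: "'a set \<Rightarrow> 'a set set \<Rightarrow> 'a \<Rightarrow> 'a list \<Rightarrow> 'a \<Rightarrow> bool" where
  "graph_walk V E u p v \<longleftrightarrow>
     p \<noteq> [] \<and> hd p = u \<and> last p = v \<and> set p \<subseteq> V \<and> successively (\<lambda>x y. {x, y} \<in> E) p"

definition graph_path :: "'a set \<Rightarrow> 'a set set \<Rightarrow> 'a \<Rightarrow> 'a list \<Rightarrow> 'a \<Rightarrow> bool" where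
  "graph_path V E u p v \<longleftrightarrow> graph_walk V E u p v \<and> distinct p"

definition connected_graph :: "'a set \<Rightarrow> 'a set set \<Rightarrow> bool" where
  "connected_graph V E \<longleftrightarrow> V \<noteq> {} \<and> (\<forall>u\<in>V. \<forall>v\<in>V. \<exists>p. graph_walk V E u p v)"

definition graph_cycle :: "'a set \<Rightarrow> 'a set set \<Rightarrow> 'a list \<Rightarrow> bool" where
  "graph_cycle V E p \<longleftrightarrow> length p \<ge> 3 \<and> graph_path V E (hd p) p (last p) \<and> {last p, hd p} \<in> E"

definition graph_tree :: "'a set \<Rightarrow> 'a set set \<Rightarrow> bool" where
  "graph_tree V E \<longleftrightarrow> simple_graph V E \<and> connected_graph V E \<and> \<not> (\<exists>p. graph_cycle V E p)"

text \<open>The distance is only meaningful for vertices in the same connected component.\<close>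

definition graph_dist :: "'a set \<Rightarrow> 'a set set \<Rightarrow> 'a \<Rightarrow> 'a \<Rightarrow> nat" where
  "graph_dist V E u v = (LEAST d. \<exists>p. graph_walk V E u p v \<and> length p = Suc d)"

record 'a rooted_graph =
  verts :: "'a set"
  edges :: "'a set set"
  root :: 'a

definition rooted_tree :: "'a rooted_graph \<Rightarrow> bool" where
  "rooted_tree T \<longleftrightarrow> graph_tree (verts T) (edges T) \<and> root T \<in> verts T"

definition vertex_level :: "'a rooted_graph \<Rightarrow> 'a \<Rightarrow> nat" where
  "vertex_level T x = graph_dist (verts T) (edges T) (root T) x"

definition level :: "'a rooted_graph \<Rightarrow> nat \<Rightarrow> 'a set" where
  "level T l = {x \<in> verts T. vertex_level T x = l}"

definition children :: "'a rooted_graph \<Rightarrow> 'a \<Rightarrow> 'a set" where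
  "children T x = {y \<in> verts T. {x, y} \<in> edges T \<and> vertex_level T y = vertex_level T x + 1}"

definition bary_tree :: "nat \<Rightarrow> 'a rooted_graph \<Rightarrow> bool" where
  "bary_tree b T \<longleftrightarrow> rooted_tree T \<and> (\<forall>x\<in>verts T. card (children T x) \<le> b)"

definition filled :: "nat \<Rightarrow> 'a rooted_graph \<Rightarrow> nat \<Rightarrow> bool" where
  "filled b T l \<longleftrightarrow> card (level T l) = b ^ l"

text \<open>The vertices \<open>y\<close> of the subtree rooted at \<open>x\<close> are \<open>x\<close> and its descendants: those for
  which \<open>x\<close> lies on the (unique) path from the root to \<open>y\<close>.\<close>

definition subtree_verts :: "'a rooted_graph \<Rightarrow> 'a \<Rightarrow> 'a set" where
  "subtree_verts T x =
     {y \<in> verts T. \<exists>p. graph_path (verts T) (edges T) (root T) p y \<and> x \<in> set p}"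

definition subtree_size :: "'a rooted_graph \<Rightarrow> 'a \<Rightarrow> nat" where
  "subtree_size T x = card (subtree_verts T x)"

definition balanced_bary_tree :: "nat \<Rightarrow> 'a rooted_graph \<Rightarrow> bool" where
  "balanced_bary_tree b T \<longleftrightarrow>
     bary_tree b T \<and>
     (\<forall>l. level T l \<noteq> {} \<and> (\<exists>m>l. level T m \<noteq> {}) \<longrightarrow> filled b T l) \<and>
     (\<forall>x\<in>verts T. \<forall>y\<in>verts T. vertex_level T x = vertex_level T y \<longrightarrow>
        \<bar>int (subtree_size T x) - int (subtree_size T y)\<bar> \<le> 1)"

definition G_edges :: "'a rooted_graph \<Rightarrow> 'a rooted_graph \<Rightarrow> ('a \<Rightarrow> 'a) \<Rightarrow> 'a set set" where
  "G_edges S T \<phi> = {{\<phi> i, \<phi> j} | i j. {i, j} \<in> edges S} \<union> edges T"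

definition crossing_edges :: "'a set \<Rightarrow> 'a set set \<Rightarrow> 'a set \<Rightarrow> 'a set set" where
  "crossing_edges V E U = {e \<in> E. \<exists>u\<in>U. \<exists>v\<in>V - U. e = {u, v}}"

definition balanced_cut :: "'a set \<Rightarrow> 'a set \<Rightarrow> bool" where
  "balanced_cut V U \<longleftrightarrow>
     U \<subseteq> V \<and> real (card V) / 3 \<le> real (card U) \<and> real (card U) \<le> 2 * real (card V) / 3"

end

theory Submission
  imports "HOL-Analysis.Elementary_Normed_Spaces" "HOL-Library.Sublist" Defs
begin

text \<open>In a balanced \<open>b\<close>-ary tree on \<open>n\<close> vertices a subtree rooted at level \<open>l\<close> has
  \<open>n / b ^ l + O(1)\<close> vertices, and \<open>|U|\<close> is a signed sum of the sizes of the subtrees below the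
  crossing edges, plus \<open>n\<close> if the root lies in \<open>U\<close>. So a set \<open>U\<close> with at most \<open>k\<close> crossing
  edges has \<open>|U| / n = s + O(k / n)\<close>, where \<open>s\<close> is a sum of at most \<open>k\<close> signed powers of
  \<open>1 / b\<close>, plus \<open>0\<close> or \<open>1\<close>. For fixed \<open>k\<close> these sums form a compact set of rationals whose
  denominators are powers of \<open>b\<close>. A number that is both dyadic and triadic is an integer, so
  within \<open>[1/4, 3/4]\<close> the compact sets for \<open>b = 2\<close> and \<open>b = 3\<close> are disjoint, hence at a positive
  distance, which is impossible for large \<open>n\<close> if a balanced cut existed.\<close>

section \<open>Paths in trees\<close>

text \<open>Cutting out the closed stretch between two occurrences of a repeated vertex leaves a
  shorter walk. The length bound matters later: distances are defined by walks, root paths are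
  paths.\<close>

lemma graph_walk_shorten:
  assumes "graph_walk V E u p v"
  shows "\<exists>q. graph_path V E u q v \<and> length q \<le> length p"
  using assms
proof (induction "length p" arbitrary: p rule: less_induct)
  case less
  show ?case
  proof (cases "distinct p")
    case True
    then show ?thesis using less.prems by (auto simp: graph_path_def)
  next
    case False
    then obtain a b c x where p: "p = a @ [x] @ b @ [x] @ c"
      using not_distinct_decomp by blast
    let ?p = "a @ [x] @ c"
    have "graph_walk V E u ?p v"
      using less.prems unfolding p graph_walk_def
      by (cases c) (auto simp: successively_append_iff successively_Cons hd_append split: if_splits)
    moreover have "length ?p < length p" by (simp add: p)
    ultimately show ?thesis using less.hyps by (meson less_imp_le order_trans)
  qed
qed

text \<open>Two different paths part after their longest common prefix \<open>r\<close> and must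
  meet again because their ends agree. The two segments between the last vertex \<open>w\<close> of
  \<open>r\<close> and the meeting point \<open>z\<close> then close up to a cycle.\<close>

lemma graph_path_unique:
  assumes acyclic: "\<not> (\<exists>c. graph_cycle V E c)"
    and p: "graph_path V E u p v" and q: "graph_path V E u q v"
  shows "p = q"
proof (rule ccontr)
  assume "p \<noteq> q"
  define r where "r = longest_common_prefix p q"
  obtain p' where p': "p = r @ p'"
    using longest_common_prefix_prefix1 unfolding r_def prefix_def by blast
  obtain q' where q': "q = r @ q'"
    using longest_common_prefix_prefix2 unfolding r_def prefix_def by blast
  have hd_neq: "hd p' \<noteq> hd q'" if "p' \<noteq> []" "q' \<noteq> []"
  proof
    assume "hd p' = hd q'"
    then have "prefix (r @ [hd p']) p" "prefix (r @ [hd p']) q"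
      using that p' q' by (cases p'; cases q'; simp)+
    then have "prefix (r @ [hd p']) r"
      unfolding r_def by (rule longest_common_prefix_max_prefix)
    then show False by (simp add: prefix_def)
  qed
  have "p \<noteq> []" "q \<noteq> []" "hd p = hd q"
    using p q by (auto simp: graph_path_def graph_walk_def)
  then have "r \<noteq> []" using hd_neq p' q' by (cases "r = []") auto
  have lst: "last p = last q" and dist: "distinct p" "distinct q"
    using p q by (auto simp: graph_path_def graph_walk_def)
  \<comment> \<open>If one path ended with \<open>r\<close>, the other would visit its last vertex a
    second time.\<close>
  have "p' \<noteq> []"
  proof
    assume "p' = []"
    then have "q' \<noteq> []" "last r = last q'" using \<open>p \<noteq> q\<close> p' q' lst by auto
    then have "last q' \<in> set r \<inter> set q'" using \<open>r \<noteq> []\<close> by (metis Int_iff last_in_set)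
    then show False using dist q' by auto
  qed
  have "q' \<noteq> []"
  proof
    assume "q' = []"
    then have "p' \<noteq> []" "last r = last p'" using \<open>p \<noteq> q\<close> p' q' lst by auto
    then have "last p' \<in> set r \<inter> set p'" using \<open>r \<noteq> []\<close> by (metis Int_iff last_in_set)
    then show False using dist p' by auto
  qed
  define w where "w = last r"
  have r: "r @ xs = butlast r @ w # xs" for xs
  proof -
    have "butlast r @ w # xs = (butlast r @ [w]) @ xs" by simp
    also have "butlast r @ [w] = r" using \<open>r \<noteq> []\<close> by (simp add: w_def)
    finally show ?thesis by simp
  qed
  have "last p' = last q'" using lst p' q' \<open>p' \<noteq> []\<close> \<open>q' \<noteq> []\<close> by simp
  \<comment> \<open>Choosing \<open>z\<close> as the first vertex of \<open>p'\<close> that lies on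
    \<open>q'\<close> keeps \<open>a\<close> disjoint from \<open>q'\<close>, so the cycle repeats
    no vertex.\<close>
  then have "\<exists>z\<in>set p'. z \<in> set q'" using \<open>p' \<noteq> []\<close> \<open>q' \<noteq> []\<close> by (metis last_in_set)
  then obtain a z b where ab: "p' = a @ z # b" "z \<in> set q'" "\<forall>y\<in>set a. y \<notin> set q'"
    using split_list_first_prop[of p' "\<lambda>z. z \<in> set q'"] by blast
  obtain c d where cd: "q' = c @ z # d" using split_list[OF ab(2)] by blast
  let ?c = "w # a @ z # rev c"
  have p_eq: "p = butlast r @ w # a @ z # b" using trans[OF p' r] unfolding ab(1) .
  have q_eq: "q = butlast r @ w # c @ z # d" using trans[OF q' r] unfolding cd .
  have pw: "successively (\<lambda>x y. {x, y} \<in> E) (butlast r @ w # a @ z # b)"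
      "set (butlast r @ w # a @ z # b) \<subseteq> V" "distinct (butlast r @ w # a @ z # b)"
    using p unfolding p_eq graph_path_def graph_walk_def by simp_all
  have qw: "successively (\<lambda>x y. {x, y} \<in> E) (butlast r @ w # c @ z # d)"
      "set (butlast r @ w # c @ z # d) \<subseteq> V" "distinct (butlast r @ w # c @ z # d)"
    using q unfolding q_eq graph_path_def graph_walk_def by simp_all
  have "set ?c \<subseteq> V" using pw(2) qw(2) by auto
  moreover have "distinct ?c" using pw(3) qw(3) ab(3) cd by auto
  moreover have "successively (\<lambda>x y. {x, y} \<in> E) ?c"
  proof -
    have 1: "successively (\<lambda>x y. {x, y} \<in> E) (w # a @ [z])"
      using pw(1) by (auto simp: successively_append_iff successively_Cons hd_append split: if_splits)
    have "successively (\<lambda>x y. {x, y} \<in> E) (c @ [z])"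
      using qw(1) by (auto simp: successively_append_iff successively_Cons hd_append split: if_splits)
    then have "successively (\<lambda>x y. {x, y} \<in> E) (rev (c @ [z]))"
      by (subst successively_rev) (simp add: insert_commute)
    then have 2: "successively (\<lambda>x y. {x, y} \<in> E) (z # rev c)" by simp
    show ?thesis using 1 2
      by (auto simp: successively_append_iff successively_Cons hd_append split: if_splits)
  qed
  moreover have "{last ?c, hd ?c} \<in> E"
    using qw(1) by (cases c) (auto simp: successively_append_iff successively_Cons insert_commute)
  \<comment> \<open>\<open>a\<close> and \<open>c\<close> cannot both be empty, since otherwise both
    continuations after \<open>r\<close> would start with \<open>z\<close>.\<close>
  moreover have "length ?c \<ge> 3"
    using hd_neq[OF \<open>p' \<noteq> []\<close> \<open>q' \<noteq> []\<close>] ab cd by (cases a; cases c) auto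
  ultimately have "graph_cycle V E ?c"
    unfolding graph_cycle_def graph_path_def graph_walk_def by simp
  then show False using acyclic by blast
qed

section \<open>Root paths, parents and levels\<close>

locale tree_with_root =
  fixes T :: "'a rooted_graph"
  assumes tree: "rooted_tree T"
begin

abbreviation "V \<equiv> verts T"
abbreviation "E \<equiv> edges T"
abbreviation "rt \<equiv> rooted_graph.root T"

definition root_path :: "'a \<Rightarrow> 'a list" where
  "root_path y = (THE p. graph_path V E rt p y)"

text \<open>At the root this is \<open>last []\<close>, an unspecified value; hence the exclusion of
  \<open>rt\<close> in what follows.\<close>

definition parent :: "'a \<Rightarrow> 'a" where
  "parent y = last (butlast (root_path y))"

lemma finite_verts [simp]: "finite V"
  and root_in_verts [simp]: "rt \<in> V"
  and edge_subset: "e \<in> E \<Longrightarrow> e \<subseteq> V \<and> card e = 2"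
  using tree by (auto simp: rooted_tree_def graph_tree_def simple_graph_def)

lemma acyclic: "\<not> (\<exists>c. graph_cycle V E c)"
  using tree unfolding rooted_tree_def graph_tree_def by blast

lemma root_path_eqI: "graph_path V E rt p y \<Longrightarrow> root_path y = p"
  unfolding root_path_def using graph_path_unique[OF acyclic] by (intro the_equality)

lemma root_path_path:
  assumes "y \<in> V" shows "graph_path V E rt (root_path y) y"
proof -
  obtain p where "graph_walk V E rt p y"
    using tree assms root_in_verts unfolding rooted_tree_def graph_tree_def connected_graph_def
    by metis
  then obtain q where "graph_path V E rt q y" using graph_walk_shorten by metis
  then show ?thesis using root_path_eqI by metis
qed

lemma root_path_props:
  assumes "y \<in> V"
  shows "root_path y \<noteq> []" "last (root_path y) = y" "hd (root_path y) = rt"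
    "set (root_path y) \<subseteq> V" "distinct (root_path y)" "y \<in> set (root_path y)"
  using root_path_path[OF assms] last_in_set[of "root_path y"]
  by (auto simp: graph_path_def graph_walk_def)

lemma root_path_prefix:
  assumes "y \<in> V" "root_path y = p @ x # q"
  shows "root_path x = p @ [x]" "x \<in> V"
proof -
  have "graph_path V E rt (p @ [x]) x"
    using root_path_path[OF assms(1)] unfolding assms(2) graph_path_def graph_walk_def
    by (auto simp: successively_append_iff hd_append successively_Cons split: if_splits)
  then show "root_path x = p @ [x]" by (rule root_path_eqI)
  show "x \<in> V" using root_path_props(4)[OF assms(1)] assms(2) by auto
qed

lemma root_path_root [simp]: "root_path rt = [rt]"
  by (rule root_path_eqI) (simp add: graph_path_def graph_walk_def)

text \<open>A shortest walk can be shortened to a path, and the only path from the root is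
  \<open>root_path y\<close>; so the distance is attained there. The \<open>Suc\<close> arises
  because lists count vertices and levels count edges.\<close>

lemma length_root_path:
  assumes "y \<in> V" shows "length (root_path y) = Suc (vertex_level T y)"
proof -
  have "graph_dist V E rt y = length (root_path y) - 1"
    unfolding graph_dist_def
  proof (rule Least_equality)
    show "\<exists>p. graph_walk V E rt p y \<and> length p = Suc (length (root_path y) - 1)"
      using root_path_path[OF assms] root_path_props(1)[OF assms] by (auto simp: graph_path_def)
  next
    fix d assume "\<exists>p. graph_walk V E rt p y \<and> length p = Suc d"
    then obtain q where "graph_path V E rt q y" "length q \<le> Suc d"
      using graph_walk_shorten by metis
    then show "length (root_path y) - 1 \<le> d" using root_path_eqI by fastforce
  qed
  then show ?thesis using root_path_props(1)[OF assms] by (simp add: vertex_level_def)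
qed

lemma root_path_parent:
  assumes "y \<in> V" "y \<noteq> rt"
  shows "root_path y = root_path (parent y) @ [y]" "parent y \<in> V" "{parent y, y} \<in> E"
proof -
  let ?p = "root_path y"
  have p: "?p = butlast ?p @ [y]" using root_path_props[OF assms(1)] by (metis append_butlast_last_id)
  have ne: "butlast ?p \<noteq> []" using p root_path_props(3)[OF assms(1)] assms(2)
    by (metis append_Nil list.sel(1))
  then have p2: "?p = butlast (butlast ?p) @ parent y # [y]"
    using p by (metis append_butlast_last_id append.assoc append_Cons append_Nil parent_def)
  show "root_path y = root_path (parent y) @ [y]" "parent y \<in> V"
    using root_path_prefix[OF assms(1) p2] p2 by auto
  show "{parent y, y} \<in> E"
  proof -
    have "successively (\<lambda>x y. {x, y} \<in> E) ?p"
      using root_path_path[OF assms(1)] by (simp add: graph_path_def graph_walk_def)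
    then have "successively (\<lambda>x y. {x, y} \<in> E) (butlast (butlast ?p) @ parent y # [y])"
      by (rule subst[OF p2])
    then show ?thesis by (simp add: successively_append_iff)
  qed
qed

lemma subtree_verts_eq: "subtree_verts T x = {y \<in> V. x \<in> set (root_path y)}"
proof -
  have "(\<exists>p. graph_path V E rt p y \<and> x \<in> set p) \<longleftrightarrow> x \<in> set (root_path y)" if "y \<in> V" for y
    using root_path_path[OF that] by (auto dest: root_path_eqI)
  then show ?thesis unfolding subtree_verts_def by blast
qed

lemma level_parent:
  assumes "y \<in> V" "y \<noteq> rt" shows "vertex_level T y = Suc (vertex_level T (parent y))"
  using root_path_parent[OF assms] length_root_path[OF assms(1)] length_root_path[of "parent y"]
  by simp

section \<open>Counting vertices by the subtrees that contain them\<close>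

lemma telescope_root_path:
  fixes f :: "'a \<Rightarrow> real"
  assumes "y \<in> V"
  shows "f y = f rt + (\<Sum>x\<in>set (root_path y) - {rt}. f x - f (parent x))"
  using assms
proof (induction "vertex_level T y" arbitrary: y rule: less_induct)
  case less
  show ?case
  proof (cases "y = rt")
    case False
    note p = root_path_parent[OF less.prems False]
    have "f (parent y) = f rt + (\<Sum>x\<in>set (root_path (parent y)) - {rt}. f x - f (parent x))"
      using less.hyps p(2) level_parent[OF less.prems False] by simp
    moreover have "set (root_path y) - {rt} = insert y (set (root_path (parent y)) - {rt})"
      using p(1) False by auto
    moreover have "y \<notin> set (root_path (parent y))"
      using p(1) root_path_props(5)[OF less.prems] by auto
    ultimately show ?thesis by simp
  qed simp
qed

text \<open>Telescope \<open>f y\<close> along the root path of \<open>y\<close> and exchange the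
  sums: the increment at \<open>x\<close> is counted once for each \<open>y\<close> below
  \<open>x\<close>. For the indicator of a set \<open>U\<close> only the vertices separated from
  their parents by \<open>U\<close> survive, which ties the size of \<open>U\<close> to its crossing
  edges.\<close>

lemma sum_verts_eq:
  fixes f :: "'a \<Rightarrow> real"
  shows "(\<Sum>y\<in>V. f y) = card V * f rt +
    (\<Sum>x\<in>V - {rt}. (f x - f (parent x)) * subtree_size T x)"
proof -
  have "(\<Sum>y\<in>V. f y) = (\<Sum>y\<in>V. f rt + (\<Sum>x\<in>set (root_path y) - {rt}. f x - f (parent x)))"
    by (rule sum.cong[OF refl telescope_root_path])
  also have "\<dots> = card V * f rt + (\<Sum>y\<in>V. \<Sum>x\<in>set (root_path y) - {rt}. f x - f (parent x))"
    by (simp add: sum.distrib)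
  also have "(\<Sum>y\<in>V. \<Sum>x\<in>set (root_path y) - {rt}. f x - f (parent x)) =
      (\<Sum>y\<in>V. \<Sum>x\<in>V - {rt}. if x \<in> set (root_path y) then f x - f (parent x) else 0)"
  proof (rule sum.cong[OF refl])
    fix y assume "y \<in> V"
    then have "set (root_path y) - {rt} = {x \<in> V - {rt}. x \<in> set (root_path y)}"
      using root_path_props(4) by auto
    then show "(\<Sum>x\<in>set (root_path y) - {rt}. f x - f (parent x)) =
      (\<Sum>x\<in>V - {rt}. if x \<in> set (root_path y) then f x - f (parent x) else 0)"
      by (simp add: sum.If_cases Int_def)
  qed
  also have "\<dots> = (\<Sum>x\<in>V - {rt}. \<Sum>y\<in>V. if x \<in> set (root_path y) then f x - f (parent x) else 0)"
    by (rule sum.swap)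
  also have "\<dots> = (\<Sum>x\<in>V - {rt}. (f x - f (parent x)) * subtree_size T x)"
    by (intro sum.cong refl)
      (simp add: sum.If_cases Int_def subtree_size_def subtree_verts_eq mult.commute)
  finally show ?thesis .
qed

lemma vertex_level_root_path_nth:
  assumes "y \<in> V" "i < length (root_path y)"
  shows "vertex_level T (root_path y ! i) = i"
proof -
  have "root_path y = take i (root_path y) @ root_path y ! i # drop (Suc i) (root_path y)"
    using assms(2) by (simp add: id_take_nth_drop)
  from root_path_prefix[OF assms(1) this] show ?thesis
    using length_root_path[of "root_path y ! i"] assms(2) by simp
qed

text \<open>Double counting: a vertex of level at least \<open>l\<close> has exactly one ancestor on
  level \<open>l\<close>, namely entry \<open>l\<close> of its root path, and any other vertex has
  none.\<close>

lemma sum_subtree_size_level: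
  "(\<Sum>x\<in>level T l. subtree_size T x) = card {y \<in> V. l \<le> vertex_level T y}"
proof -
  have fin: "finite (level T l)" by (simp add: level_def)
  have "(\<Sum>x\<in>level T l. subtree_size T x) =
      (\<Sum>x\<in>level T l. \<Sum>y\<in>V. if x \<in> set (root_path y) then 1 else 0)"
    by (simp add: subtree_size_def subtree_verts_eq sum.If_cases Int_def)
  also have "\<dots> = (\<Sum>y\<in>V. \<Sum>x\<in>level T l. if x \<in> set (root_path y) then 1 else 0)"
    by (rule sum.swap)
  also have "\<dots> = (\<Sum>y\<in>V. if l \<le> vertex_level T y then 1 else 0)"
  proof (rule sum.cong[OF refl])
    fix y assume y: "y \<in> V"
    have "level T l \<inter> set (root_path y) = (if l \<le> vertex_level T y then {root_path y ! l} else {})"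
    proof (intro equalityI subsetI)
      fix x assume "x \<in> level T l \<inter> set (root_path y)"
      then show "x \<in> (if l \<le> vertex_level T y then {root_path y ! l} else {})"
        using vertex_level_root_path_nth[OF y] length_root_path[OF y]
        by (auto simp: level_def in_set_conv_nth)
    next
      fix x assume "x \<in> (if l \<le> vertex_level T y then {root_path y ! l} else {})"
      then have l: "l < length (root_path y)" and x: "x = root_path y ! l"
        using length_root_path[OF y] by (auto split: if_splits)
      then show "x \<in> level T l \<inter> set (root_path y)"
        using vertex_level_root_path_nth[OF y l] nth_mem[OF l] root_path_props(4)[OF y]
        by (auto simp: level_def)
    qed
    then show "(\<Sum>x\<in>level T l. if x \<in> set (root_path y) then 1 else 0) =
      (if l \<le> vertex_level T y then 1 else 0::nat)"
      using fin by (simp add: sum.If_cases)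
  qed
  also have "\<dots> = card {y \<in> V. l \<le> vertex_level T y}" by (simp add: sum.If_cases Int_def)
  finally show ?thesis .
qed

section \<open>Sizes of levels and of subtrees\<close>

lemma vertex_level_root: "vertex_level T rt = 0"
  using length_root_path[of rt] by simp

lemma level_0: "level T 0 = {rt}"
proof -
  have "y = rt" if "y \<in> V" "vertex_level T y = 0" for y
    using level_parent that by fastforce
  then show ?thesis using vertex_level_root by (auto simp: level_def)
qed

lemma card_level_le:
  assumes "\<forall>x\<in>V. card (children T x) \<le> b"
  shows "card (level T l) \<le> b ^ l"
proof (induction l)
  case 0 show ?case by (simp add: level_0)
next
  case (Suc l)
  have fin: "finite (level T l)" "\<And>x. finite (children T x)" by (simp_all add: level_def children_def)
  have "y \<in> (\<Union>x\<in>level T l. children T x)" if "y \<in> level T (Suc l)" for y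
  proof -
    have y: "y \<in> V" "y \<noteq> rt" using that vertex_level_root by (auto simp: level_def)
    show ?thesis using that root_path_parent[OF y] level_parent[OF y] y
      by (auto simp: level_def children_def intro!: bexI[of _ "parent y"])
  qed
  then have "card (level T (Suc l)) \<le> card (\<Union>x\<in>level T l. children T x)"
    by (intro card_mono) (auto simp: fin)
  also have "\<dots> \<le> (\<Sum>x\<in>level T l. card (children T x))" by (rule card_UN_le[OF fin(1)])
  also have "\<dots> \<le> card (level T l) * b"
    using sum_bounded_above[of "level T l" "\<lambda>x. card (children T x)" b] assms
    by (auto simp: level_def)
  also have "\<dots> \<le> b ^ Suc l" using Suc by simp
  finally show ?case .
qed

text \<open>A crude geometric sum: \<open>b \<ge> 2\<close> lets \<open>b ^ l + b ^ l\<close> fit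
  into \<open>b ^ Suc l\<close>.\<close>

lemma card_below_level:
  assumes "\<forall>x\<in>V. card (children T x) \<le> b" "b \<ge> 2"
  shows "card {y \<in> V. vertex_level T y < l} \<le> b ^ l"
proof (induction l)
  case (Suc l)
  have "{y \<in> V. vertex_level T y < Suc l} = {y \<in> V. vertex_level T y < l} \<union> level T l"
    by (auto simp: level_def)
  then have "card {y \<in> V. vertex_level T y < Suc l} \<le> b ^ l + b ^ l"
    using Suc card_level_le[OF assms(1), of l] card_Un_le[of "{y \<in> V. vertex_level T y < l}" "level T l"]
    by simp
  also have "\<dots> = 2 * b ^ l" by simp
  also have "\<dots> \<le> b ^ Suc l" using mult_le_mono1[OF assms(2), of "b ^ l"] by simp
  finally show ?case .
qed simp


lemma in_subtree_level_le_imp_eq: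
  assumes "y \<in> subtree_verts T x" "vertex_level T y \<le> vertex_level T x"
  shows "y = x"
proof -
  have y: "y \<in> V" "x \<in> set (root_path y)" using assms(1) by (auto simp: subtree_verts_eq)
  then obtain i where i: "i < length (root_path y)" "root_path y ! i = x"
    by (auto simp: in_set_conv_nth)
  have lx: "vertex_level T x = i" using vertex_level_root_path_nth[OF y(1) i(1)] i(2) by simp
  have "i = length (root_path y) - 1" using assms(2) lx i(1) length_root_path[OF y(1)] by simp
  then show "y = x" using i(2) root_path_props(1,2)[OF y(1)] by (simp add: last_conv_nth)
qed

text \<open>On a filled level \<open>l\<close> the \<open>b ^ l\<close> subtrees have nearly equal
  sizes and together miss only the at most \<open>b ^ l\<close> vertices above. Multiplied by
  \<open>b ^ l\<close>, the error is at most \<open>b ^ l\<close> from the unequal sizes and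
  \<open>b ^ l\<close> from the missing vertices, which explains the constant 2.\<close>

lemma subtree_size_approx:
  assumes bal: "balanced_bary_tree b T" and b: "b \<ge> 2" and x: "x \<in> V"
  shows "\<bar>real (subtree_size T x) - card V / b ^ vertex_level T x\<bar> \<le> 2"
proof -
  define l where "l = vertex_level T x"
  have ch: "\<forall>x\<in>V. card (children T x) \<le> b"
    using bal by (simp add: balanced_bary_tree_def bary_tree_def)
  have fin: "finite (level T l)" by (simp add: level_def)
  have pos: "real b ^ l > 0" using b by simp
  have "V = {y \<in> V. vertex_level T y < l} \<union> {y \<in> V. l \<le> vertex_level T y}" by auto
  then have "card V = card {y \<in> V. vertex_level T y < l} + card {y \<in> V. l \<le> vertex_level T y}"
    by (subst card_Un_disjoint[symmetric]) auto
  then have split: "card V = card {y \<in> V. vertex_level T y < l} + (\<Sum>y\<in>level T l. subtree_size T y)"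
    by (simp add: sum_subtree_size_level)
  have below: "card {y \<in> V. vertex_level T y < l} \<le> b ^ l" by (rule card_below_level[OF ch b])
  have "\<bar>real (b ^ l) * subtree_size T x - card V\<bar> \<le> 2 * real (b ^ l)"
  \<comment> \<open>Balance guarantees a filled level only if a later level is non-empty, so the
    last level needs its own argument.\<close>
  proof (cases "\<exists>m>l. level T m \<noteq> {}")
    case True
    have "level T l \<noteq> {}" using x by (auto simp: level_def l_def)
    then have fill: "card (level T l) = b ^ l"
      using bal True unfolding balanced_bary_tree_def filled_def by blast
    have near: "\<bar>real (subtree_size T x) - real (subtree_size T y)\<bar> \<le> 1" if "y \<in> level T l" for y
    proof -
      have "\<bar>int (subtree_size T x) - int (subtree_size T y)\<bar> \<le> 1"
        using bal x that unfolding balanced_bary_tree_def level_def l_def by auto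
      then show ?thesis by linarith
    qed
    have "real (b ^ l) * subtree_size T x - (\<Sum>y\<in>level T l. real (subtree_size T y)) =
        (\<Sum>y\<in>level T l. real (subtree_size T x) - real (subtree_size T y))"
      by (simp add: sum_subtractf fill)
    also have "\<bar>\<dots>\<bar> \<le> (\<Sum>y\<in>level T l. \<bar>real (subtree_size T x) - real (subtree_size T y)\<bar>)"
      by (rule sum_abs)
    also have "\<dots> \<le> real (card (level T l)) * 1" using near by (rule sum_bounded_above)
    finally have "\<bar>real (b ^ l) * subtree_size T x - (\<Sum>y\<in>level T l. real (subtree_size T y))\<bar> \<le> real (b ^ l)"
      by (simp add: fill)
    moreover have "real (card V) = card {y \<in> V. vertex_level T y < l} +
        (\<Sum>y\<in>level T l. real (subtree_size T y))"
      by (simp add: split)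
    moreover have "real (card {y \<in> V. vertex_level T y < l}) \<le> real (b ^ l)"
      using below by (rule of_nat_mono)
    ultimately show ?thesis by linarith
  next
    case False
    \<comment> \<open>On the last level every vertex is a leaf, and the whole tree has at most
      \<open>2 * b ^ l\<close> vertices, so 1 is close enough to the quotient.\<close>
    have leaf: "subtree_size T y = 1" if "y \<in> level T l" for y
    proof -
      have y: "y \<in> V" "vertex_level T y = l" using that by (auto simp: level_def)
      have "vertex_level T z \<le> l" if "z \<in> V" for z
      proof (rule ccontr)
        assume "\<not> vertex_level T z \<le> l"
        then have "vertex_level T z > l" "z \<in> level T (vertex_level T z)"
          using that by (auto simp: level_def)
        then show False using False by blast
      qed
      then have "subtree_verts T y \<subseteq> {y}"
        using in_subtree_level_le_imp_eq[of _ y] y by (auto simp: subtree_verts_eq)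
      moreover have "y \<in> subtree_verts T y" using y root_path_props(6) by (simp add: subtree_verts_eq)
      ultimately have "subtree_verts T y = {y}" by blast
      then show ?thesis by (simp add: subtree_size_def)
    qed
    have "(\<Sum>y\<in>level T l. subtree_size T y) = card (level T l)" using leaf by simp
    then have "card V \<le> 2 * b ^ l" using split below card_level_le[OF ch, of l] by linarith
    then have "real (card V) \<le> 2 * real (b ^ l)" by (metis of_nat_mono of_nat_mult of_nat_numeral)
    moreover have "subtree_size T x = 1" using leaf x by (simp add: level_def l_def)
    ultimately show ?thesis by simp
  qed
  then have "\<bar>(real (b ^ l) * subtree_size T x - card V) / real (b ^ l)\<bar> \<le> 2"
    using pos by (simp add: abs_divide pos_divide_le_eq)
  then show ?thesis using b by (auto simp: l_def[symmetric] diff_divide_distrib split: if_splits)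
qed

text \<open>Send each such vertex to the edge to its parent, which crosses \<open>U\<close>. This is
  injective: two vertices with the same parent edge would be parents of each other, contradicting
  their levels.\<close>

lemma card_crossing_parents:
  assumes "U \<subseteq> V"
  shows "card {x \<in> V - {rt}. (x \<in> U) \<noteq> (parent x \<in> U)} \<le> card (crossing_edges V E U)"
proof (rule card_inj_on_le)
  let ?X = "{x \<in> V - {rt}. (x \<in> U) \<noteq> (parent x \<in> U)}"
  show "inj_on (\<lambda>x. {parent x, x}) ?X"
  proof (rule inj_onI, rule ccontr)
    fix x y assume xy: "x \<in> ?X" "y \<in> ?X" "{parent x, x} = {parent y, y}" "x \<noteq> y"
    then have "x = parent y" "y = parent x" by (auto simp: doubleton_eq_iff)
    then show False using level_parent[of x] level_parent[of y] xy by simp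
  qed
  show "(\<lambda>x. {parent x, x}) ` ?X \<subseteq> crossing_edges V E U"
    using root_path_parent unfolding crossing_edges_def by (auto simp: insert_commute)
  have "crossing_edges V E U \<subseteq> Pow V" using edge_subset by (auto simp: crossing_edges_def)
  then show "finite (crossing_edges V E U)" by (rule finite_subset) simp
qed

end

section \<open>Sums of boundedly many signed powers\<close>

text \<open>The element 0 is the limit of both sequences, which yields compactness, and it also
  serves to pad sums with fewer terms.\<close>

definition signed_powers :: "nat \<Rightarrow> real set" where
  "signed_powers b = insert 0 (range (\<lambda>l. (1 / b) ^ l)) \<union> insert 0 (range (\<lambda>l. - ((1 / b) ^ l)))"

text \<open>The base set \<open>{0, 1}\<close> records whether the root lies in the cut set.\<close>

fun power_sums :: "nat \<Rightarrow> nat \<Rightarrow> real set" where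
  "power_sums b 0 = {0, 1}"
| "power_sums b (Suc k) = {x + y | x y. x \<in> power_sums b k \<and> y \<in> signed_powers b}"

text \<open>A convergent sequence together with its limit is compact, and so is the set of sums of
  two compact sets.\<close>

lemma compact_power_sums:
  assumes "b \<ge> 2" shows "compact (power_sums b k)"
proof (induction k)
  case (Suc k)
  have lim: "(\<lambda>l. (1 / real b) ^ l) \<longlonglongrightarrow> 0" using assms by (intro LIMSEQ_realpow_zero) auto
  have "compact (signed_powers b)"
    unfolding signed_powers_def using tendsto_minus[OF lim]
    by (intro compact_Un compact_sequence_with_limit lim) simp
  with Suc show ?case by (simp add: compact_sums)
qed simp

lemma power_sums_mono:
  assumes "k \<le> j" shows "power_sums b k \<subseteq> power_sums b j"
  using assms
proof (induction rule: dec_induct)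
  case (step j)
  have "x \<in> power_sums b (Suc j)" if "x \<in> power_sums b j" for x
  proof -
    have "x = x + 0" "0 \<in> signed_powers b" by (simp_all add: signed_powers_def)
    then show ?thesis using that unfolding power_sums.simps by blast
  qed
  with step show ?case by blast
qed simp

lemma sum_in_power_sums:
  assumes "finite X" "c \<in> {0, 1}" "\<And>x. x \<in> X \<Longrightarrow> g x \<in> signed_powers b"
  shows "c + sum g X \<in> power_sums b (card X)"
  using assms(1,3)
proof (induction X rule: finite_induct)
  case empty
  then show ?case using assms(2) by auto
next
  case (insert x X)
  then have "c + sum g X \<in> power_sums b (card X)" "g x \<in> signed_powers b" by auto
  moreover have "c + sum g (insert x X) = (c + sum g X) + g x" using insert by simp
  ultimately have "c + sum g (insert x X) \<in> power_sums b (Suc (card X))"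
    unfolding power_sums.simps by blast
  then show ?case using insert by simp
qed

lemma power_sums_denominator:
  assumes "b > 0" "s \<in> power_sums b k"
  shows "\<exists>m. s * real b ^ m \<in> \<int>"
  using assms(2)
proof (induction k arbitrary: s)
  case 0
  then show ?case by (auto intro!: exI[of _ 0])
next
  case (Suc k)
  then obtain x y where xy: "s = x + y" "x \<in> power_sums b k" "y \<in> signed_powers b" by auto
  obtain m where m: "x * real b ^ m \<in> \<int>" using Suc.IH[OF xy(2)] by blast
  have "\<exists>l. y * real b ^ l \<in> \<int>"
  proof -
    have one: "(1 / real b) ^ l * real b ^ l = 1" for l
      using assms(1) by (simp add: power_one_over)
    show ?thesis using xy(3) one by (auto simp: signed_powers_def) (metis Ints_1 Ints_minus mult_minus_left)+
  qed
  then obtain l where l: "y * real b ^ l \<in> \<int>" by blast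
  have "s * real b ^ (m + l) = (x * real b ^ m) * real b ^ l + (y * real b ^ l) * real b ^ m"
    by (simp add: xy(1) power_add algebra_simps)
  also have "\<dots> \<in> \<int>"
    by (rule Ints_add[OF Ints_mult[OF m] Ints_mult[OF l]]) (rule Ints_power[OF Ints_of_nat])+
  finally show ?case by blast
qed

text \<open>Writing \<open>s\<close> with denominators \<open>a ^ m\<close> and \<open>b ^ l\<close>
  and cross-multiplying gives \<open>z * b ^ l = w * a ^ m\<close>; by coprimality
  \<open>a ^ m\<close> divides the numerator \<open>z\<close>.\<close>

lemma power_sums_coprime_inter:
  assumes "coprime a b" "a > 0" "b > 0" "s \<in> power_sums a k" "s \<in> power_sums b j"
  shows "s \<in> \<int>"
proof -
  obtain m z where z: "s * real a ^ m = of_int z"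
    using power_sums_denominator[OF assms(2,4)] by (auto elim: Ints_cases)
  obtain l w where w: "s * real b ^ l = of_int w"
    using power_sums_denominator[OF assms(3,5)] by (auto elim: Ints_cases)
  have "real_of_int (z * int b ^ l) = (s * real a ^ m) * real b ^ l" by (simp add: z)
  also have "\<dots> = (s * real b ^ l) * real a ^ m" by simp
  also have "\<dots> = real_of_int (w * int a ^ m)" by (simp add: w)
  finally have "z * int b ^ l = w * int a ^ m" by (simp only: of_int_eq_iff)
  then have "int a ^ m dvd z * int b ^ l" by simp
  moreover have "coprime (int a ^ m) (int b ^ l)" using assms(1) by simp
  ultimately have "int a ^ m dvd z" by (simp add: coprime_dvd_mult_left_iff)
  then obtain q where "z = int a ^ m * q" by (auto elim: dvdE)
  then have "s * real a ^ m = of_int q * real a ^ m" using z by simp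
  then have "s = of_int q" using assms(2) by simp
  then show ?thesis by simp
qed

section \<open>Cuts of balanced trees\<close>

text \<open>Apply \<open>sum_verts_eq\<close> to the indicator of \<open>U\<close>. At most
  \<open>k\<close> vertices contribute, each with sign 1 or -1, and replacing a subtree size by its
  approximation costs at most 2 per vertex.\<close>

lemma balanced_tree_cut_size:
  fixes T :: "'a rooted_graph"
  assumes bal: "balanced_bary_tree b T" and b: "b \<ge> 2" and U: "U \<subseteq> verts T"
    and k: "card (crossing_edges (verts T) (edges T) U) \<le> k"
  shows "\<exists>s\<in>power_sums b k. \<bar>real (card U) - card (verts T) * s\<bar> \<le> 2 * real k"
proof -
  interpret tree_with_root T
    by standard (use bal in \<open>simp add: balanced_bary_tree_def bary_tree_def\<close>)
  define f :: "'a \<Rightarrow> real" where "f = indicator U"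
  define X where "X = {x \<in> V - {rt}. (x \<in> U) \<noteq> (parent x \<in> U)}"
  define g where "g x = (f x - f (parent x)) * (1 / b) ^ vertex_level T x" for x
  define s where "s = f rt + sum g X"
  have fin: "finite X" by (simp add: X_def)
  have cX: "card X \<le> k" using card_crossing_parents[OF U] k by (simp add: X_def)
  have diff: "f x - f (parent x) \<in> {1, -1}" if "x \<in> X" for x
    using that by (auto simp: X_def f_def indicator_def)
  have "g x \<in> signed_powers b" if "x \<in> X" for x
    using diff[OF that] by (auto simp: g_def signed_powers_def)
  then have "s \<in> power_sums b (card X)"
    unfolding s_def using fin by (intro sum_in_power_sums) (auto simp: f_def indicator_def)
  then have s: "s \<in> power_sums b k" using power_sums_mono[OF cX] by blast
  have "real (card U) = (\<Sum>y\<in>V. f y)"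
    using U by (simp add: f_def indicator_def sum.If_cases Int_absorb1)
  also have "\<dots> = card V * f rt + (\<Sum>x\<in>V - {rt}. (f x - f (parent x)) * subtree_size T x)"
    by (rule sum_verts_eq)
  \<comment> \<open>Outside \<open>X\<close> a vertex and its parent lie on the same side of the
    cut, so the increment vanishes.\<close>
  also have "(\<Sum>x\<in>V - {rt}. (f x - f (parent x)) * subtree_size T x) =
      (\<Sum>x\<in>X. (f x - f (parent x)) * subtree_size T x)"
    by (rule sum.mono_neutral_right) (auto simp: X_def f_def indicator_def)
  finally have "real (card U) - card V * s =
      (\<Sum>x\<in>X. (f x - f (parent x)) * subtree_size T x) - (\<Sum>x\<in>X. card V * g x)"
    by (simp add: s_def distrib_left sum_distrib_left)
  also have "\<dots> = (\<Sum>x\<in>X. (f x - f (parent x)) *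
      (real (subtree_size T x) - card V / b ^ vertex_level T x))"
    by (simp add: sum_subtractf[symmetric] g_def power_inverse algebra_simps divide_inverse)
  also have "\<bar>\<dots>\<bar> \<le> (\<Sum>x\<in>X. \<bar>(f x - f (parent x)) *
      (real (subtree_size T x) - card V / b ^ vertex_level T x)\<bar>)"
    by (rule sum_abs)
  also have "\<dots> \<le> real (card X) * 2"
  proof (rule sum_bounded_above)
    fix x assume x: "x \<in> X"
    then have "x \<in> V" by (simp add: X_def)
    from subtree_size_approx[OF bal b this] diff[OF x]
    show "\<bar>(f x - f (parent x)) * (real (subtree_size T x) - card V / b ^ vertex_level T x)\<bar> \<le> 2"
      by (auto simp: abs_mult)
  qed
  also have "\<dots> \<le> 2 * real k" using cX by simp
  finally show ?thesis using s by blast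
qed

section \<open>Passing from the union graph to each of the two trees\<close>

lemma crossing_edges_mono:
  assumes "E \<subseteq> E'" shows "crossing_edges V E U \<subseteq> crossing_edges V E' U"
  using assms by (auto simp: crossing_edges_def)

text \<open>Instead of relabelling the binary tree by \<open>\<phi>\<close>, the cut is pulled back:
  edges crossing the preimage of \<open>U\<close> map injectively to edges crossing
  \<open>U\<close>.\<close>

lemma card_crossing_edges_vimage:
  assumes \<phi>: "\<phi> permutes V" and U: "U \<subseteq> V" and fin: "finite (crossing_edges V E' U)"
    and sub: "(`) \<phi> ` E \<subseteq> E'"
  shows "card (crossing_edges V E (\<phi> -` U)) \<le> card (crossing_edges V E' U)"
proof (rule card_inj_on_le[OF _ _ fin])
  have "inj \<phi>" using \<phi> by (rule permutes_inj)
  then show "inj_on ((`) \<phi>) (crossing_edges V E (\<phi> -` U))"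
    by (auto simp: inj_on_def inj_image_eq_iff)
  show "(`) \<phi> ` crossing_edges V E (\<phi> -` U) \<subseteq> crossing_edges V E' U"
  proof
    fix e' assume "e' \<in> (`) \<phi> ` crossing_edges V E (\<phi> -` U)"
    then obtain u v where uv: "{u, v} \<in> E" "\<phi> u \<in> U" "v \<in> V" "\<phi> v \<notin> U" "e' = \<phi> ` {u, v}"
      unfolding crossing_edges_def by blast
    then have "e' \<in> E'" "\<phi> v \<in> V - U" "e' = {\<phi> u, \<phi> v}"
      using sub permutes_in_image[OF \<phi>] by auto
    then show "e' \<in> crossing_edges V E' U" using uv(2) unfolding crossing_edges_def by blast
  qed
qed

theorem theorem14:
  fixes T :: "nat \<Rightarrow> nat \<Rightarrow> nat rooted_graph"
  assumes "\<And>b n. b \<in> {2, 3} \<Longrightarrow> n \<ge> 1 \<Longrightarrow> balanced_bary_tree b (T b n) \<and> verts (T b n) = {1..n}"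
  shows "\<forall>k::nat. k \<ge> 1 \<longrightarrow> (\<exists>N::nat. \<forall>n\<ge>N. \<forall>\<phi>. \<phi> permutes {1..n} \<longrightarrow>
           \<not> (\<exists>U. balanced_cut {1..n} U \<and>
                  card (crossing_edges {1..n} (G_edges (T 2 n) (T 3 n) \<phi>) U) \<le> k))"
proof (intro allI impI)
  fix k :: nat assume "k \<ge> 1"
  \<comment> \<open>The window contains no integer and extends the range from 1/3 to 2/3 by 1/12 on
    each side, leaving room for the approximation error.\<close>
  define A where "A b = power_sums b k \<inter> {1/4..3/4::real}" for b
  have comp: "compact (A b)" if "b \<ge> 2" for b
    unfolding A_def by (rule compact_Int_closed[OF compact_power_sums[OF that]]) simp
  have "A 2 \<inter> A 3 = {}"
  proof (rule ccontr)
    assume "A 2 \<inter> A 3 \<noteq> {}"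
    then obtain s where s: "s \<in> power_sums 2 k" "s \<in> power_sums 3 k" "1/4 \<le> s" "s \<le> 3/4"
      unfolding A_def by auto
    have "coprime (2::nat) 3" by simp
    from power_sums_coprime_inter[OF this _ _ s(1,2)] obtain q :: int where "s = of_int q"
      by (auto elim: Ints_cases)
    then have "0 < q" "q < 1" using s(3,4) by linarith+
    then show False by simp
  qed
  then obtain d where d: "d > 0" "\<And>x y. x \<in> A 2 \<Longrightarrow> y \<in> A 3 \<Longrightarrow> d \<le> dist x y"
    using separate_compact_closed[OF comp[of 2] compact_imp_closed[OF comp[of 3]]] by auto
  \<comment> \<open>The bound \<open>24 * k\<close> makes the relative error
    \<open>2 * k / n\<close> smaller than 1/12, keeping the power sums in the window; the bound
    \<open>4 * k / d\<close> contradicts the gap \<open>d\<close> at the end.\<close>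
  obtain N :: nat where N: "real N > max (4 * k / d) (24 * k)" using reals_Archimedean2 by blast
  have "\<not> (\<exists>U. balanced_cut {1..n} U \<and>
      card (crossing_edges {1..n} (G_edges (T 2 n) (T 3 n) \<phi>) U) \<le> k)"
    if n: "n \<ge> N" and \<phi>: "\<phi> permutes {1..n}" for n \<phi>
  proof
    assume "\<exists>U. balanced_cut {1..n} U \<and>
      card (crossing_edges {1..n} (G_edges (T 2 n) (T 3 n) \<phi>) U) \<le> k"
    then obtain U where U: "U \<subseteq> {1..n}" "real n / 3 \<le> card U" "card U \<le> 2 * real n / 3"
      and cr: "card (crossing_edges {1..n} (G_edges (T 2 n) (T 3 n) \<phi>) U) \<le> k" (is "card ?C \<le> k")
      by (auto simp: balanced_cut_def)
    have big: "real n > 4 * k / d" "real n > 24 * k" using N n by auto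
    then have n0: "real n > 0" "n \<ge> 1" by (auto intro: Suc_leI)
    have T2: "balanced_bary_tree 2 (T 2 n)" "verts (T 2 n) = {1..n}"
      and T3: "balanced_bary_tree 3 (T 3 n)" "verts (T 3 n) = {1..n}"
      using assms n0(2) by auto
    have E: "edges (T 2 n) \<subseteq> {e. e \<subseteq> {1..n} \<and> card e = 2}"
      using T2 by (auto simp: balanced_bary_tree_def bary_tree_def rooted_tree_def
        graph_tree_def simple_graph_def)
    have C: "?C \<subseteq> Pow {1..n}" using U(1) by (auto simp: crossing_edges_def)
    have fin: "finite ?C" by (rule finite_subset[OF C]) simp
    have near: "\<exists>s\<in>A b. \<bar>real (card U) - real n * s\<bar> \<le> 2 * real k"
      if ex: "\<exists>s\<in>power_sums b k. \<bar>real (card U) - real n * s\<bar> \<le> 2 * real k" for b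
    proof -
      obtain s where s: "s \<in> power_sums b k" "\<bar>real (card U) - real n * s\<bar> \<le> 2 * real k"
        using ex by blast
      have "real n * (1/4) \<le> real n * s" "real n * s \<le> real n * (3/4)"
        using s(2) U(2,3) big(2) by linarith+
      then show ?thesis using s n0(1) by (auto simp: A_def)
    qed
    have "card (crossing_edges {1..n} (edges (T 3 n)) U) \<le> card ?C"
      by (rule card_mono[OF fin crossing_edges_mono]) (simp add: G_edges_def)
    then obtain t where t: "t \<in> A 3" "\<bar>real (card U) - real n * t\<bar> \<le> 2 * real k"
      using near[of 3] balanced_tree_cut_size[OF T3(1), of U k] T3(2) U(1) cr by auto
    have "(`) \<phi> ` edges (T 2 n) \<subseteq> G_edges (T 2 n) (T 3 n) \<phi>"
    proof
      fix e assume "e \<in> (`) \<phi> ` edges (T 2 n)"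
      then obtain i j where "{i, j} \<in> edges (T 2 n)" "e = {\<phi> i, \<phi> j}"
        using E by (auto simp: card_2_iff)
      then show "e \<in> G_edges (T 2 n) (T 3 n) \<phi>" unfolding G_edges_def by blast
    qed
    from card_crossing_edges_vimage[OF \<phi> U(1) fin this]
    have "card (crossing_edges {1..n} (edges (T 2 n)) (\<phi> -` U)) \<le> k" using cr by simp
    moreover have "\<phi> -` U \<subseteq> {1..n}" using U(1) permutes_in_image[OF \<phi>] by blast
    \<comment> \<open>Equal cardinalities mean that the sums \<open>s\<close> and \<open>t\<close>
      from the two trees approximate the same number.\<close>
    moreover have "card (\<phi> -` U) = card U"
      using permutes_bij[OF \<phi>] by (simp add: card_vimage_inj bij_is_inj bij_is_surj)
    ultimately obtain s where s: "s \<in> A 2" "\<bar>real (card U) - real n * s\<bar> \<le> 2 * real k"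
      using near[of 2] balanced_tree_cut_size[OF T2(1), of "\<phi> -` U" k] T2(2) by auto
    \<comment> \<open>Both \<open>n * s\<close> and \<open>n * t\<close> are within
      \<open>2 * k\<close> of the size of \<open>U\<close>, hence within \<open>4 * k\<close> of
      each other.\<close>
    have "real n * dist s t = \<bar>real n * s - real n * t\<bar>"
      by (simp add: dist_real_def abs_mult right_diff_distrib[symmetric])
    also have "\<dots> \<le> 4 * k" using s(2) t(2) by linarith
    finally have "real n * d \<le> 4 * k"
      using d(2)[OF s(1) t(1)] mult_left_mono[of d "dist s t" "real n"] by linarith
    then show False using big(1) d(1) by (simp add: pos_divide_less_eq)
  qed
  then show "\<exists>N. \<forall>n\<ge>N. \<forall>\<phi>. \<phi> permutes {1..n} \<longrightarrow>
      \<not> (\<exists>U. balanced_cut {1..n} U \<and>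
        card (crossing_edges {1..n} (G_edges (T 2 n) (T 3 n) \<phi>) U) \<le> k)"
    by blast
qed

end
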